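(* Let $p>1$, $\alpha>\beta>0$, $T>0$, $\delta>0$. Let $c\in C^1([0,T]\times[0,\delta])$ satisfy, for all $(t,x)\in[0,T]\times[0,\delta]$, $$L_0x^p\le c(t,x)\le L_1x^p,\qquad L_2x^{p-1}\le c_x(t,x)\le L_3x^{p-1},\qquad |c_t(t,x)|\le L_4x^p,$$ with positive constants $L_0,\dots,L_4$. Let $u_0,u_1$ be functions on $[0,\delta]$ satisfying, for all $x\in[0,\delta]$, $$K_0x^\alpha\le u_0(x)\le K_1x^\alpha,\qquad K_2x^\beta\le u_1(x)\le K_3x^\beta,$$ with positive constants $K_0,\dots,K_3$. Let $u$ be a solution of $$u_{tt}=\bigl(c(t,x)^2u_x\bigr)_x,\qquad u(0,x)=u_0(x),\quad u_t(0,x)=u_1(x),$$ such that $$u\in C([0,T]\times[0,\delta])\cap C^2([0,T]\times(0,\delta]),\qquad u_t,\ c(t,x)u_x\in C([0,T]\times[0,\delta]).$$ Then, provided that $T>0$ is sufficiently small, $u$ satisfies $$C_1\,t\,x^\beta\le u(t,x)\le C_2\,x^\beta .$$ That is, there exist $T_1\in(0,T]$, $\delta_1\in(0,\delta)$ and constants $C_1,C_2>0$ such that this estimate holds for all $(t,x)\in[0,T_1]\times[0,\delta_1]$.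
   Context: All functions are real-valued. The equation is required to hold pointwise for $(t,x)\in[0,T]\times(0,\delta]$, with one-sided derivatives at the endpoints $t=0$, $t=T$, $x=\delta$. The conditions $u_t,\ c\,u_x\in C([0,T]\times[0,\delta])$ mean that these functions, defined on $[0,T]\times(0,\delta]$, extend continuously up to $x=0$. The numbers $T_1,\delta_1,C_1,C_2$ may depend on $c$, the data, the constants and the solution $u$, but not on $(t,x)$. *)

theory Defs
  imports "HOL-Analysis.Analysis"
begin

(* A function of (t, x) is a function on real \<times> real; t is the first coordinate. Partial
   derivatives are taken within the slices of the domain S, so on a product of nondegenerate
   intervals they are one-sided at the endpoints contained in S and the usual ones elsewhere. *)

definition partial_t :: "(real \<times> real) set \<Rightarrow> (real \<times> real \<Rightarrow> real) \<Rightarrow> real \<times> real \<Rightarrow> real" where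
  "partial_t S f = (\<lambda>(t, x). vector_derivative (\<lambda>s. f (s, x)) (at t within {s. (s, x) \<in> S}))"

definition partial_x :: "(real \<times> real) set \<Rightarrow> (real \<times> real \<Rightarrow> real) \<Rightarrow> real \<times> real \<Rightarrow> real" where
  "partial_x S f = (\<lambda>(t, x). vector_derivative (\<lambda>y. f (t, y)) (at x within {y. (t, y) \<in> S}))"

definition partially_differentiable_on :: "(real \<times> real \<Rightarrow> real) \<Rightarrow> (real \<times> real) set \<Rightarrow> bool" where
  "partially_differentiable_on f S \<longleftrightarrow>
     (\<forall>(t, x) \<in> S. (\<lambda>s. f (s, x)) differentiable (at t within {s. (s, x) \<in> S}) \<and>
                   (\<lambda>y. f (t, y)) differentiable (at x within {y. (t, y) \<in> S}))"

primrec Ck_on :: "nat \<Rightarrow> (real \<times> real \<Rightarrow> real) \<Rightarrow> (real \<times> real) set \<Rightarrow> bool" where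
  "Ck_on 0 f S \<longleftrightarrow> continuous_on S f"
| "Ck_on (Suc k) f S \<longleftrightarrow> continuous_on S f \<and> partially_differentiable_on f S \<and>
     Ck_on k (partial_t S f) S \<and> Ck_on k (partial_x S f) S"

(* v and w are the continuous extensions to x = 0 of u_t and c u_x, which are themselves only
   defined for x > 0; v also gives the initial condition for u_t its meaning at x = 0. *)

definition is_solution ::
  "real \<Rightarrow> real \<Rightarrow> (real \<times> real \<Rightarrow> real) \<Rightarrow> (real \<Rightarrow> real) \<Rightarrow> (real \<Rightarrow> real) \<Rightarrow> (real \<times> real \<Rightarrow> real) \<Rightarrow> bool"
where
  "is_solution T \<delta> c u0 u1 u \<longleftrightarrow>
     (let Q = {0..T} \<times> {0..\<delta>}; S = {0..T} \<times> {0<..\<delta>} in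
        continuous_on Q u \<and> Ck_on 2 u S \<and>
        (\<exists>v w. continuous_on Q v \<and> (\<forall>z\<in>S. v z = partial_t S u z) \<and>
               continuous_on Q w \<and> (\<forall>z\<in>S. w z = c z * partial_x S u z) \<and>
               (\<forall>x\<in>{0..\<delta>}. u (0, x) = u0 x \<and> v (0, x) = u1 x)) \<and>
        (\<forall>z\<in>S. partial_t S (partial_t S u) z =
                partial_x S (\<lambda>y. (c y)\<^sup>2 * partial_x S u y) z))"

end

(* The potential phi(t, x) = int_0^t c^2 u_x(s, x) ds satisfies phi_t = c^2 u_x and, by the equation,
   phi_x = u_t - u_1. Hence for s = 1, -1 the function g_s = s phi - c u, whose derivatives contain
   u_x, has a derivative free of u_x in the characteristic direction (1, s c), namely
   -c u_1 - (c_t + s c c_x) u. A maximum principle for transport on backward triangles turns this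
   into bounds on g_s, and g_1 + g_(-1) = -2 c u. No derivative of u_0 is involved.

   A triangle with apex (t, x) stays in [x/2, 3x/2] because c = O(x). There the error term is
   at most C x^p N with N = max |u|; for small t it is absorbed, giving
   N <= C (x^alpha + t x^beta). As alpha > beta, near the origin the error is then dominated by the
   main term c u_1 ~ x^(p + beta), so that c u >= C t x^(p + beta). *)

theory Submission
  imports Defs
begin

section \<open>Total derivatives and a maximum principle for transport\<close>

text \<open>Split the increment into a move in t at fixed x and then a move in the second variable:
  the latter is controlled by continuity of \<open>fx\<close>, while for the former the derivative
  at the single point suffices. A total derivative is needed later for differentiating along slanted
  directions.\<close>

lemma has_derivative_continuous_partials:
  fixes f :: "real \<times> real \<Rightarrow> real"
  assumes ft: "((\<lambda>s. f (s, x)) has_real_derivative ft) (at t within I)"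
    and fx: "\<And>s y. s \<in> I \<Longrightarrow> y \<in> J \<Longrightarrow> ((\<lambda>y. f (s, y)) has_real_derivative fx (s, y)) (at y within J)"
    and cont: "continuous_on (I \<times> J) fx" and "convex J" "t \<in> I" "x \<in> J"
  shows "(f has_derivative (\<lambda>(h, k). ft * h + fx (t, x) * k)) (at (t, x) within I \<times> J)"
proof -
  have "((\<lambda>(s, y). f (s, y)) has_derivative
      (\<lambda>(h, k). ft * h + blinfun_scaleR_right (fx (t, x)) k)) (at (t, x) within I \<times> J)"
  proof (rule has_derivative_partialsI[where fy = "\<lambda>s y. blinfun_scaleR_right (fx (s, y))"])
    show "((\<lambda>s. f (s, x)) has_derivative (*) ft) (at t within I)"
      using ft by (simp add: has_field_derivative_def)
    show "((\<lambda>y. f (s, y)) has_derivative blinfun_scaleR_right (fx (s, y))) (at y within J)"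
      if "s \<in> I" "y \<in> J" for s y
      using fx[OF that] by (simp add: has_field_derivative_def real_scaleR_def[abs_def])
    have "((\<lambda>z. blinfun_scaleR_right (fx z)) \<longlongrightarrow>
        (blinfun_scaleR_right (fx (t, x)) :: real \<Rightarrow>\<^sub>L real))
        (at (t, x) within I \<times> J)"
      by (rule bounded_linear.tendsto[OF bounded_linear_blinfun_scaleR_right])
         (use cont assms(5,6) in \<open>auto simp: continuous_on_def\<close>)
    then show "continuous (at (t, x) within I \<times> J)
        (\<lambda>(s, y). blinfun_scaleR_right (fx (s, y)) :: real \<Rightarrow>\<^sub>L real)"
      by (simp add: continuous_within case_prod_beta')
  qed (use assms in auto)
  then show ?thesis by simp
qed

text \<open>A domain of dependence: a path of speed at most \<open>\<Lambda>\<close>, followed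
  backward in time from a point of the triangle, stays in it down to time 0. The apex is
  \<open>(\<tau>, \<xi>)\<close>.\<close>

definition backward_triangle :: "real \<Rightarrow> real \<Rightarrow> real \<Rightarrow> (real \<times> real) set" where
  "backward_triangle \<Lambda> \<tau> \<xi> = {(s, y). 0 \<le> s \<and> s \<le> \<tau> \<and> \<bar>y - \<xi>\<bar> \<le> \<Lambda> * (\<tau> - s)}"

lemma compact_backward_triangle:
  assumes "\<Lambda> \<ge> 0"
  shows "compact (backward_triangle \<Lambda> \<tau> \<xi>)"
proof -
  have "closed (backward_triangle \<Lambda> \<tau> \<xi>)"
    unfolding backward_triangle_def case_prod_beta'
    by (intro closed_Collect_conj closed_Collect_le continuous_intros)
  moreover have "backward_triangle \<Lambda> \<tau> \<xi> \<subseteq> {0..\<tau>} \<times> {\<xi> - \<Lambda> * \<tau>..\<xi> + \<Lambda> * \<tau>}"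
  proof clarify
    fix s y assume *: "(s, y) \<in> backward_triangle \<Lambda> \<tau> \<xi>"
    then have "\<Lambda> * (\<tau> - s) \<le> \<Lambda> * \<tau>"
      using assms by (intro mult_left_mono) (auto simp: backward_triangle_def)
    with * show "s \<in> {0..\<tau>} \<and> y \<in> {\<xi> - \<Lambda> * \<tau>..\<xi> + \<Lambda> * \<tau>}"
      by (auto simp: backward_triangle_def)
  qed
  ultimately show ?thesis
    using bounded_subset[OF bounded_Times[OF bounded_closed_interval bounded_closed_interval]]
    by (auto simp: compact_eq_bounded_closed)
qed

text \<open>Subtract a small multiple of time, so that f becomes strictly decreasing along the
  direction \<open>(1, k z)\<close>. A positive maximum cannot lie on the base, and from a maximum
  at positive time a step backward stays in the triangle and increases the function. Only a straight
  segment with the velocity frozen at the maximum is followed, so no characteristic curve has to be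
  constructed.\<close>

lemma transport_maximum_principle:
  fixes f :: "real \<times> real \<Rightarrow> real"
  assumes sub: "backward_triangle \<Lambda> \<tau> \<xi> \<subseteq> D" and "\<Lambda> \<ge> 0"
    and deriv: "\<And>z. z \<in> backward_triangle \<Lambda> \<tau> \<xi> \<Longrightarrow> (f has_derivative f' z) (at z within D)"
    and speed: "\<And>z. z \<in> backward_triangle \<Lambda> \<tau> \<xi> \<Longrightarrow> \<bar>k z\<bar> \<le> \<Lambda>"
    and decr: "\<And>z. z \<in> backward_triangle \<Lambda> \<tau> \<xi> \<Longrightarrow> f' z (1, k z) \<le> 0"
    and base: "\<And>y. (0, y) \<in> backward_triangle \<Lambda> \<tau> \<xi> \<Longrightarrow> f (0, y) \<le> 0"
    and z0: "z0 \<in> backward_triangle \<Lambda> \<tau> \<xi>"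
  shows "f z0 \<le> 0"
proof (rule ccontr)
  assume "\<not> f z0 \<le> 0"
  then have pos: "f z0 > 0" by simp
  let ?\<Omega> = "backward_triangle \<Lambda> \<tau> \<xi>"
  have "fst z0 \<le> \<tau>" "\<tau> \<ge> 0" using z0 by (auto simp: backward_triangle_def)
  \<comment> \<open>Small enough that \<open>f - \<epsilon> * s\<close> is still positive at
    \<open>z0\<close>; the 1 in the denominator makes the inequality strict and covers \<tau> =
    0.\<close>
  define \<epsilon> where "\<epsilon> = f z0 / (\<tau> + 1)"
  have "\<epsilon> > 0" using pos \<open>\<tau> \<ge> 0\<close> by (simp add: \<epsilon>_def)
  have "\<epsilon> * fst z0 \<le> \<epsilon> * \<tau>" using \<open>\<epsilon> > 0\<close> \<open>fst z0 \<le> \<tau>\<close> by simp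
  also have "\<dots> < f z0" using pos \<open>\<tau> \<ge> 0\<close> by (simp add: \<epsilon>_def field_simps)
  finally have pos': "f z0 - \<epsilon> * fst z0 > 0" by simp
  have "continuous_on ?\<Omega> f"
    by (rule has_derivative_continuous_on, rule has_derivative_subset[OF deriv sub])
  then have "continuous_on ?\<Omega> (\<lambda>z. f z - \<epsilon> * fst z)"
    by (intro continuous_intros)
  then obtain z where z: "z \<in> ?\<Omega>" and max: "\<And>w. w \<in> ?\<Omega> \<Longrightarrow> f w - \<epsilon> * fst w \<le> f z - \<epsilon> * fst z"
    using continuous_attains_sup[OF compact_backward_triangle[OF \<open>\<Lambda> \<ge> 0\<close>]] z0 by blast
  obtain s y where sy: "z = (s, y)" by (cases z)
  have "s \<noteq> 0" using base[of y] max[OF z0] pos' z sy by auto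
  then have "s > 0" using z sy by (auto simp: backward_triangle_def)
  \<comment> \<open>Backward segment from the maximum; the speed bound keeps it inside the triangle,
    which widens at rate \<Lambda>.\<close>
  define \<gamma> where "\<gamma> = (\<lambda>r. (s - r, y - r * k z))"
  have \<gamma>: "\<gamma> r \<in> ?\<Omega>" if "r \<in> {0..s}" for r
  proof -
    have "\<bar>y - r * k z - \<xi>\<bar> \<le> \<bar>y - \<xi>\<bar> + r * \<bar>k z\<bar>"
      using abs_triangle_ineq4[of "y - \<xi>" "r * k z"] that by (simp add: abs_mult algebra_simps)
    also have "\<dots> \<le> \<Lambda> * (\<tau> - s) + r * \<Lambda>"
      using z sy speed[OF z] that by (intro add_mono mult_left_mono) (auto simp: backward_triangle_def)
    also have "\<dots> = \<Lambda> * (\<tau> - (s - r))" by (simp add: algebra_simps)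
    finally show ?thesis using that z sy by (auto simp: \<gamma>_def backward_triangle_def)
  qed
  have "(\<gamma> has_derivative (\<lambda>r. (- r, - r * k z))) (at 0 within {0..s})"
    unfolding \<gamma>_def by (auto intro!: derivative_eq_intros)
  moreover have "(f has_derivative f' z) (at (\<gamma> 0) within \<gamma> ` {0..s})"
  proof (rule has_derivative_subset)
    show "(f has_derivative f' z) (at (\<gamma> 0) within D)"
      using deriv[OF z] by (simp add: \<gamma>_def sy)
    show "\<gamma> ` {0..s} \<subseteq> D"
      using \<gamma> sub by blast
  qed
  ultimately have "((\<lambda>r. f (\<gamma> r)) has_derivative (\<lambda>r. f' z (- r, - r * k z))) (at 0 within {0..s})"
    by (rule has_derivative_in_compose)
  moreover have "(\<lambda>r. f' z (- r, - r * k z)) = (*) (- f' z (1, k z))"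
  proof
    fix r
    interpret bounded_linear "f' z" using deriv[OF z] by (rule has_derivative_bounded_linear)
    have "(- r, - r * k z) = (- r) *\<^sub>R (1, k z)" by simp
    then show "f' z (- r, - r * k z) = - f' z (1, k z) * r"
      using scaleR[of "- r" "(1, k z)"] by simp
  qed
  ultimately have "((\<lambda>r. f (\<gamma> r)) has_real_derivative - f' z (1, k z)) (at 0 within {0..s})"
    by (simp add: has_field_derivative_def)
  then have "((\<lambda>r. f (\<gamma> r) - \<epsilon> * fst (\<gamma> r)) has_real_derivative - f' z (1, k z) + \<epsilon>) (at 0 within {0..s})"
    unfolding \<gamma>_def by (auto intro!: derivative_eq_intros)
  \<comment> \<open>The one-sided derivative is at least \<epsilon>, so the penalised function
    exceeds its maximum just before time s.\<close>
  from has_real_derivative_pos_inc_right[OF this] obtain d where "d > 0"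
    and inc: "\<And>h. h > 0 \<Longrightarrow> h \<in> {0..s} \<Longrightarrow> h < d \<Longrightarrow>
      f (\<gamma> 0) - \<epsilon> * fst (\<gamma> 0) < f (\<gamma> h) - \<epsilon> * fst (\<gamma> h)"
    using decr[OF z] \<open>\<epsilon> > 0\<close> by (auto simp del: atLeastAtMost_iff)
  define h where "h = min s (d / 2)"
  have "h > 0" "h \<in> {0..s}" "h < d" using \<open>s > 0\<close> \<open>d > 0\<close> by (auto simp: h_def)
  from inc[OF this] max[OF \<gamma>[OF this(2)]] show False by (simp add: \<gamma>_def sy)
qed


section \<open>The potential and its combinations along characteristics\<close>

text \<open>The equation is kept in divergence form, as \<open>utt\<close> being the x-derivative of
  c^2 u_x, since this is what is integrated in time. The strip x > 0 leaves out the line where c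
  degenerates.\<close>

locale wave_equation =
  fixes T \<delta> :: real and c ct cx u ut ux utt :: "real \<times> real \<Rightarrow> real"
  assumes c_t: "\<lbrakk>t \<in> {0..T}; x \<in> {0<..\<delta>}\<rbrakk> \<Longrightarrow>
      ((\<lambda>s. c (s, x)) has_real_derivative ct (t, x)) (at t within {0..T})"
    and c_x: "\<lbrakk>t \<in> {0..T}; x \<in> {0<..\<delta>}\<rbrakk> \<Longrightarrow>
      ((\<lambda>y. c (t, y)) has_real_derivative cx (t, x)) (at x within {0<..\<delta>})"
    and u_t: "\<lbrakk>t \<in> {0..T}; x \<in> {0<..\<delta>}\<rbrakk> \<Longrightarrow>
      ((\<lambda>s. u (s, x)) has_real_derivative ut (t, x)) (at t within {0..T})"
    and u_x: "\<lbrakk>t \<in> {0..T}; x \<in> {0<..\<delta>}\<rbrakk> \<Longrightarrow>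
      ((\<lambda>y. u (t, y)) has_real_derivative ux (t, x)) (at x within {0<..\<delta>})"
    and ut_t: "\<lbrakk>t \<in> {0..T}; x \<in> {0<..\<delta>}\<rbrakk> \<Longrightarrow>
      ((\<lambda>s. ut (s, x)) has_real_derivative utt (t, x)) (at t within {0..T})"
    and wave: "\<lbrakk>t \<in> {0..T}; x \<in> {0<..\<delta>}\<rbrakk> \<Longrightarrow>
      ((\<lambda>y. (c (t, y))\<^sup>2 * ux (t, y)) has_real_derivative utt (t, x)) (at x within {0<..\<delta>})"
    and cont: "continuous_on ({0..T} \<times> {0<..\<delta>}) c" "continuous_on ({0..T} \<times> {0<..\<delta>}) cx"
      "continuous_on ({0..T} \<times> {0<..\<delta>}) u" "continuous_on ({0..T} \<times> {0<..\<delta>}) ut"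
      "continuous_on ({0..T} \<times> {0<..\<delta>}) ux" "continuous_on ({0..T} \<times> {0<..\<delta>}) utt"
begin

definition flux :: "real \<times> real \<Rightarrow> real" where
  "flux z = (c z)\<^sup>2 * ux z"

definition potential :: "real \<times> real \<Rightarrow> real" where
  "potential = (\<lambda>(t, x). integral {0..t} (\<lambda>s. flux (s, x)))"

lemma continuous_on_flux: "continuous_on ({0..T} \<times> {0<..\<delta>}) flux"
  unfolding flux_def using cont by (intro continuous_intros)

lemma continuous_on_slice:
  assumes "continuous_on ({0..T} \<times> {0<..\<delta>}) f" "x \<in> {0<..\<delta>}"
  shows "continuous_on {0..T} (\<lambda>s. f (s, x))"
  by (rule continuous_on_compose2[OF assms(1)]) (use assms(2) in \<open>auto intro!: continuous_intros\<close>)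

lemma potential_t:
  assumes "t \<in> {0..T}" "x \<in> {0<..\<delta>}"
  shows "((\<lambda>s. potential (s, x)) has_real_derivative flux (t, x)) (at t within {0..T})"
  unfolding potential_def prod.case
  using integral_has_real_derivative[OF continuous_on_slice[OF continuous_on_flux assms(2)] assms(1)] .

text \<open>Differentiation under the integral sign turns the x-derivative of the flux into
  \<open>utt\<close> by the equation, and integrating \<open>utt\<close> in time leaves the
  increment of \<open>ut\<close>.\<close>

lemma potential_x:
  assumes "t \<in> {0..T}" "x \<in> {0<..\<delta>}"
  shows "((\<lambda>y. potential (t, y)) has_real_derivative ut (t, x) - ut (0, x)) (at x within {0<..\<delta>})"
proof -
  have sub: "{0..t} \<subseteq> {0..T}" using assms(1) by auto
  have "((\<lambda>y. integral (cbox 0 t) (\<lambda>s. flux (s, y))) has_real_derivative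
      integral (cbox 0 t) (\<lambda>s. utt (s, x))) (at x within {0<..\<delta>})"
  proof (rule leibniz_rule_field_derivative)
    show "((\<lambda>y. flux (s, y)) has_real_derivative utt (s, y)) (at y within {0<..\<delta>})"
      if "y \<in> {0<..\<delta>}" "s \<in> cbox 0 t" for y s
      using wave[of s y] that sub by (auto simp: flux_def)
    show "(\<lambda>s. flux (s, y)) integrable_on cbox 0 t" if "y \<in> {0<..\<delta>}" for y
      using continuous_on_subset[OF continuous_on_slice[OF continuous_on_flux that] sub]
      by (simp add: integrable_continuous_interval)
    have "continuous_on ({0<..\<delta>} \<times> cbox 0 t) (\<lambda>z. utt (snd z, fst z))"
      by (rule continuous_on_compose2[OF cont(6)]) (use sub in \<open>auto intro!: continuous_intros\<close>)
    then show "continuous_on ({0<..\<delta>} \<times> cbox 0 t) (\<lambda>(y, s). utt (s, y))"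
      by (simp add: case_prod_beta')
  qed (use assms in auto)
  moreover have "((\<lambda>s. utt (s, x)) has_integral ut (t, x) - ut (0, x)) {0..t}"
  proof (rule fundamental_theorem_of_calculus)
    show "((\<lambda>s. ut (s, x)) has_vector_derivative utt (s, x)) (at s within {0..t})"
      if "s \<in> {0..t}" for s
      using DERIV_subset[OF ut_t[of s x] sub] that assms sub
      by (auto simp: has_real_derivative_iff_has_vector_derivative)
  qed (use assms in auto)
  ultimately show ?thesis
    by (simp add: potential_def integral_unique)
qed

definition invariant :: "real \<Rightarrow> real \<times> real \<Rightarrow> real" where
  "invariant \<sigma> z = \<sigma> * potential z - c z * u z"

definition invariant_deriv :: "real \<Rightarrow> real \<times> real \<Rightarrow> real \<times> real \<Rightarrow> real" where
  "invariant_deriv \<sigma> z = (\<lambda>(h, k). (\<sigma> * flux z - (ct z * u z + c z * ut z)) * h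
      + (\<sigma> * (ut z - ut (0, snd z)) - (cx z * u z + c z * ux z)) * k)"

lemma invariant_has_derivative:
  assumes "z \<in> {0..T} \<times> {0<..\<delta>}"
  shows "(invariant \<sigma> has_derivative invariant_deriv \<sigma> z) (at z within {0..T} \<times> {0<..\<delta>})"
proof -
  obtain t x where z: "z = (t, x)" "t \<in> {0..T}" "x \<in> {0<..\<delta>}" using assms by auto
  let ?gx = "\<lambda>z. \<sigma> * (ut z - ut (0, snd z)) - (cx z * u z + c z * ux z)"
  have "(invariant \<sigma> has_derivative (\<lambda>(h, k). (\<sigma> * flux (t, x) - (ct (t, x) * u (t, x) + c (t, x) * ut (t, x))) * h
      + ?gx (t, x) * k)) (at (t, x) within {0..T} \<times> {0<..\<delta>})"
  \<comment> \<open>The t-derivative contains \<open>ct\<close>, for which the locale states no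
    continuity; the x-derivative is built from continuous functions.\<close>
  proof (rule has_derivative_continuous_partials)
    show "((\<lambda>s. invariant \<sigma> (s, x)) has_real_derivative
        \<sigma> * flux (t, x) - (ct (t, x) * u (t, x) + c (t, x) * ut (t, x))) (at t within {0..T})"
      unfolding invariant_def using z
      by (auto intro!: derivative_eq_intros potential_t c_t u_t simp: algebra_simps)
    show "((\<lambda>y. invariant \<sigma> (s, y)) has_real_derivative ?gx (s, y)) (at y within {0<..\<delta>})"
      if "s \<in> {0..T}" "y \<in> {0<..\<delta>}" for s y
      unfolding invariant_def using that
      by (auto intro!: derivative_eq_intros potential_x c_x u_x simp: algebra_simps)
    have "continuous_on ({0..T} \<times> {0<..\<delta>}) (\<lambda>z. ut (0, snd z))"
      by (rule continuous_on_compose2[OF cont(4)]) (auto intro!: continuous_intros)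
    then show "continuous_on ({0..T} \<times> {0<..\<delta>}) ?gx"
      using cont by (intro continuous_intros)
  qed (use z in auto)
  then show ?thesis by (simp add: invariant_deriv_def z)
qed

text \<open>In the direction \<open>(1, \<sigma> * c z)\<close> the flux term cancels against
  \<open>c * ux\<close> multiplied by the speed, and \<open>c * ut\<close> cancels because \<sigma>
  squared is 1. Only the initial velocity and a term of order zero in u remain.\<close>

lemma invariant_deriv_characteristic:
  assumes "\<sigma> * \<sigma> = 1"
  shows "invariant_deriv \<sigma> z (1, \<sigma> * c z) =
    - c z * ut (0, snd z) - (ct z + \<sigma> * c z * cx z) * u z"
proof -
  have *: "\<sigma> * (\<sigma> * a) = a" for a using assms by (simp flip: mult.assoc)
  show ?thesis
    by (simp add: invariant_deriv_def flux_def power2_eq_square algebra_simps *)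
qed

section \<open>Two-sided bounds on one backward triangle\<close>

context
  fixes \<Lambda> \<tau> \<xi> c0 c1 d m0 m1 n N :: real
  assumes sub: "backward_triangle \<Lambda> \<tau> \<xi> \<subseteq> {0..T} \<times> {0<..\<delta>}"
    and c_bounds: "\<And>z. z \<in> backward_triangle \<Lambda> \<tau> \<xi> \<Longrightarrow> c0 \<le> c z \<and> c z \<le> c1"
    and const_bounds: "0 \<le> c0" "c1 \<le> \<Lambda>" "0 \<le> m0"
    and d_bound: "\<And>z. z \<in> backward_triangle \<Lambda> \<tau> \<xi> \<Longrightarrow> \<bar>ct z\<bar> + c z * \<bar>cx z\<bar> \<le> d"
    and u1_bounds: "\<And>y. (0, y) \<in> backward_triangle \<Lambda> \<tau> \<xi> \<Longrightarrow> m0 \<le> ut (0, y) \<and> ut (0, y) \<le> m1"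
    and u0_bounds: "\<And>y. (0, y) \<in> backward_triangle \<Lambda> \<tau> \<xi> \<Longrightarrow> 0 \<le> u (0, y) \<and> u (0, y) \<le> n"
    and u_bound: "\<And>z. z \<in> backward_triangle \<Lambda> \<tau> \<xi> \<Longrightarrow> \<bar>u z\<bar> \<le> N"
begin

text \<open>Along characteristics \<open>- invariant \<sigma>\<close> grows at a rate between
  \<open>c0 * m0 - d * N\<close> and \<open>c1 * m1 + d * N\<close>, where \<open>d * N\<close>
  bounds the term of order zero for both signs. Correcting by these rates times t gives functions
  that do not increase along characteristics. On the base the invariant is -c u, which lies between
  \<open>- c1 * n\<close> and 0.\<close>

lemma invariant_bounds:
  assumes \<sigma>: "\<sigma> = 1 \<or> \<sigma> = -1" and z: "z \<in> backward_triangle \<Lambda> \<tau> \<xi>"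
  shows "invariant \<sigma> z + (c0 * m0 - d * N) * fst z \<le> 0"
    and "- invariant \<sigma> z - c1 * n - (c1 * m1 + d * N) * fst z \<le> 0"
proof -
  let ?\<Omega> = "backward_triangle \<Lambda> \<tau> \<xi>"
  have \<Lambda>: "\<Lambda> \<ge> 0" using c_bounds[OF z] const_bounds by linarith
  have \<sigma>2: "\<sigma> * \<sigma> = 1" using \<sigma> by auto
  have speed: "\<bar>\<sigma> * c w\<bar> \<le> \<Lambda>" if "w \<in> ?\<Omega>" for w
    using \<sigma> c_bounds[OF that] const_bounds by auto
  \<comment> \<open>The transport equation at w involves \<open>ut\<close> at the point of the base
    with the same second coordinate.\<close>
  have base: "(0, snd w) \<in> ?\<Omega>" if "w \<in> ?\<Omega>" for w
    using that \<Lambda> mult_left_mono[of "\<tau> - fst w" \<tau> \<Lambda>] by (auto simp: backward_triangle_def)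
  have deriv_char: "c0 * m0 - d * N \<le> - invariant_deriv \<sigma> w (1, \<sigma> * c w)"
      "- invariant_deriv \<sigma> w (1, \<sigma> * c w) \<le> c1 * m1 + d * N" if w: "w \<in> ?\<Omega>" for w
  proof -
    have "\<bar>(ct w + \<sigma> * c w * cx w) * u w\<bar> \<le> d * N"
    proof -
      have "\<bar>ct w + \<sigma> * c w * cx w\<bar> \<le> \<bar>ct w\<bar> + c w * \<bar>cx w\<bar>"
        using \<sigma> c_bounds[OF w] const_bounds abs_triangle_ineq[of "ct w" "\<sigma> * c w * cx w"]
        by (auto simp: abs_mult)
      then show ?thesis
        unfolding abs_mult using d_bound[OF w] u_bound[OF w] by (intro mult_mono) auto
    qed
    moreover have "c0 * m0 \<le> c w * ut (0, snd w)" "c w * ut (0, snd w) \<le> c1 * m1"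
      using c_bounds[OF w] u1_bounds[OF base[OF w]] const_bounds by (intro mult_mono; auto)+
    ultimately show "c0 * m0 - d * N \<le> - invariant_deriv \<sigma> w (1, \<sigma> * c w)"
      "- invariant_deriv \<sigma> w (1, \<sigma> * c w) \<le> c1 * m1 + d * N"
      unfolding invariant_deriv_characteristic[OF \<sigma>2] by linarith+
  qed
  have cu0: "0 \<le> c (0, y) * u (0, y) \<and> c (0, y) * u (0, y) \<le> c1 * n" if "(0, y) \<in> ?\<Omega>" for y
    using c_bounds[OF that] u0_bounds[OF that] const_bounds by (auto intro!: mult_mono mult_nonneg_nonneg)
  have inv0: "invariant \<sigma> (0, y) = - c (0, y) * u (0, y)" for y
    by (simp add: invariant_def potential_def)
  note D = invariant_has_derivative[OF subsetD[OF sub], of _ \<sigma>]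
  show "invariant \<sigma> z + (c0 * m0 - d * N) * fst z \<le> 0"
  proof (rule transport_maximum_principle[OF sub \<Lambda> _ speed _ _ z,
        where f' = "\<lambda>w hk. invariant_deriv \<sigma> w hk + (c0 * m0 - d * N) * fst hk"])
    fix w assume w: "w \<in> ?\<Omega>"
    show "((\<lambda>w. invariant \<sigma> w + (c0 * m0 - d * N) * fst w) has_derivative
        (\<lambda>hk. invariant_deriv \<sigma> w hk + (c0 * m0 - d * N) * fst hk)) (at w within {0..T} \<times> {0<..\<delta>})"
      by (intro derivative_intros D w)
    show "invariant_deriv \<sigma> w (1, \<sigma> * c w) + (c0 * m0 - d * N) * fst (1, \<sigma> * c w) \<le> 0"
      using deriv_char[OF w] by simp
  qed (use cu0 inv0 in auto)
  show "- invariant \<sigma> z - c1 * n - (c1 * m1 + d * N) * fst z \<le> 0"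
  proof (rule transport_maximum_principle[OF sub \<Lambda> _ speed _ _ z,
        where f' = "\<lambda>w hk. - invariant_deriv \<sigma> w hk - (c1 * m1 + d * N) * fst hk"])
    fix w assume w: "w \<in> ?\<Omega>"
    show "((\<lambda>w. - invariant \<sigma> w - c1 * n - (c1 * m1 + d * N) * fst w) has_derivative
        (\<lambda>hk. - invariant_deriv \<sigma> w hk - (c1 * m1 + d * N) * fst hk)) (at w within {0..T} \<times> {0<..\<delta>})"
      using D[OF w] by (auto intro!: derivative_eq_intros)
    show "- invariant_deriv \<sigma> w (1, \<sigma> * c w) - (c1 * m1 + d * N) * fst (1, \<sigma> * c w) \<le> 0"
      using deriv_char[OF w] by simp
  qed (use cu0 inv0 in auto)
qed

text \<open>Adding the bounds for both signs of \<sigma> removes the potential and leaves -2 c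
  u.\<close>

lemma triangle_bounds:
  assumes "z \<in> backward_triangle \<Lambda> \<tau> \<xi>"
  shows "(c0 * m0 - d * N) * fst z \<le> c z * u z"
    and "c z * u z \<le> c1 * n + (c1 * m1 + d * N) * fst z"
  using invariant_bounds[of 1, OF _ assms] invariant_bounds[of "-1", OF _ assms]
  by (auto simp: invariant_def)

end

text \<open>Here N is the maximum of |u| on the whole triangle. The bounds at a maximum point
  estimate N in terms of itself, and the smallness of \<open>d * \<tau>\<close> closes the estimate.
  The lower bound at the apex still contains N, so that it can be combined with this estimate once
  the sizes of the data are known.\<close>

lemma apex_bounds:
  fixes \<Lambda> \<tau> \<xi> c0 c1 d m0 m1 n :: real
  assumes sub: "backward_triangle \<Lambda> \<tau> \<xi> \<subseteq> {0..T} \<times> {0<..\<delta>}"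
    and c_bounds: "\<And>z. z \<in> backward_triangle \<Lambda> \<tau> \<xi> \<Longrightarrow> c0 \<le> c z \<and> c z \<le> c1"
    and const_bounds: "0 < c0" "c1 \<le> \<Lambda>" "0 \<le> m0" "0 \<le> d" "0 \<le> \<tau>" "d * \<tau> \<le> c0 / 2"
    and d_bound: "\<And>z. z \<in> backward_triangle \<Lambda> \<tau> \<xi> \<Longrightarrow> \<bar>ct z\<bar> + c z * \<bar>cx z\<bar> \<le> d"
    and u1_bounds: "\<And>y. (0, y) \<in> backward_triangle \<Lambda> \<tau> \<xi> \<Longrightarrow> m0 \<le> ut (0, y) \<and> ut (0, y) \<le> m1"
    and u0_bounds: "\<And>y. (0, y) \<in> backward_triangle \<Lambda> \<tau> \<xi> \<Longrightarrow> 0 \<le> u (0, y) \<and> u (0, y) \<le> n"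
  obtains N where "\<bar>u (\<tau>, \<xi>)\<bar> \<le> N" "c0 * N \<le> 2 * (c1 * n + c1 * m1 * \<tau>)"
    "(c0 * m0 - d * N) * \<tau> \<le> c (\<tau>, \<xi>) * u (\<tau>, \<xi>)"
proof -
  let ?\<Omega> = "backward_triangle \<Lambda> \<tau> \<xi>"
  have apex: "(\<tau>, \<xi>) \<in> ?\<Omega>" using const_bounds by (simp add: backward_triangle_def)
  then have "\<Lambda> \<ge> 0" using c_bounds const_bounds by force
  then have base: "(0, \<xi>) \<in> ?\<Omega>" using const_bounds by (simp add: backward_triangle_def)
  have nonneg: "0 \<le> c1" "0 \<le> m1" "0 \<le> n"
    using c_bounds[OF base] u1_bounds[OF base] u0_bounds[OF base] const_bounds by linarith+
  have "continuous_on ?\<Omega> (\<lambda>z. \<bar>u z\<bar>)"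
    by (intro continuous_intros continuous_on_subset[OF cont(3) sub])
  then obtain z where z: "z \<in> ?\<Omega>" and max: "\<And>w. w \<in> ?\<Omega> \<Longrightarrow> \<bar>u w\<bar> \<le> \<bar>u z\<bar>"
    using continuous_attains_sup[OF compact_backward_triangle[OF \<open>\<Lambda> \<ge> 0\<close>]] apex by blast
  define N where "N = \<bar>u z\<bar>"
  have tri: "(c0 * m0 - d * N) * fst w \<le> c w * u w"
      "c w * u w \<le> c1 * n + (c1 * m1 + d * N) * fst w" if "w \<in> ?\<Omega>" for w
    using triangle_bounds[of \<Lambda> \<tau> \<xi> c0 c1 m0 d m1 n N] assms max that by (auto simp: N_def)
  have z_range: "0 \<le> fst z" "fst z \<le> \<tau>" using z by (auto simp: backward_triangle_def)
  have "0 \<le> N" by (simp add: N_def)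
  have dN: "d * N * fst z \<le> d * N * \<tau>"
    using z_range const_bounds \<open>0 \<le> N\<close> by (intro mult_left_mono) auto
  moreover have "c1 * m1 * fst z \<le> c1 * m1 * \<tau>"
    using z_range nonneg by (intro mult_left_mono) auto
  moreover have "0 \<le> c0 * m0 * fst z" "0 \<le> c1 * n" "0 \<le> c1 * m1 * \<tau>"
    using z_range nonneg const_bounds by simp_all
  \<comment> \<open>The sign of u is not known yet, so both bounds on c u enter.\<close>
  ultimately have "\<bar>c z * u z\<bar> \<le> c1 * n + c1 * m1 * \<tau> + d * N * \<tau>"
    using tri[OF z] by (simp add: algebra_simps abs_le_iff)
  moreover have "c0 * N \<le> \<bar>c z * u z\<bar>"
    using c_bounds[OF z] const_bounds by (auto simp: N_def abs_mult intro!: mult_right_mono)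
  ultimately have "c0 * N \<le> c1 * n + c1 * m1 * \<tau> + d * N * \<tau>" by (rule order_trans[rotated])
  \<comment> \<open>Absorption: the error uses up at most half of \<open>c0 * N\<close>.\<close>
  moreover have "2 * (d * N * \<tau>) \<le> c0 * N"
    using mult_right_mono[OF const_bounds(6) \<open>0 \<le> N\<close>] by (simp add: algebra_simps)
  ultimately have "c0 * N \<le> 2 * (c1 * n + c1 * m1 * \<tau>)" by (simp add: algebra_simps)
  then show thesis
    using that[of N] tri(1)[OF apex] max[OF apex] by (simp add: N_def)
qed

end

section \<open>From the notion of solution to pointwise derivatives\<close>

lemma partial_t_has_derivative:
  assumes "partially_differentiable_on f (A \<times> B)" "t \<in> A" "x \<in> B"
  shows "((\<lambda>s. f (s, x)) has_real_derivative partial_t (A \<times> B) f (t, x)) (at t within A)"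
proof -
  have "(\<lambda>s. f (s, x)) differentiable (at t within A)"
    using assms by (auto simp: partially_differentiable_on_def)
  then show ?thesis
    using assms by (simp add: partial_t_def has_real_derivative_iff_has_vector_derivative vector_derivative_works)
qed

lemma partial_x_has_derivative:
  assumes "(\<lambda>y. f (t, y)) differentiable (at x within B)" "t \<in> A" "x \<in> B"
  shows "((\<lambda>y. f (t, y)) has_real_derivative partial_x (A \<times> B) f (t, x)) (at x within B)"
  using assms by (simp add: partial_x_def has_real_derivative_iff_has_vector_derivative vector_derivative_works)

lemma partially_differentiable_onD_x:
  assumes "partially_differentiable_on f (A \<times> B)" "t \<in> A" "x \<in> B"
  shows "(\<lambda>y. f (t, y)) differentiable (at x within B)"
  using assms by (auto simp: partially_differentiable_on_def)

lemma solution_wave_equation: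
  assumes c: "Ck_on 1 c ({0..T} \<times> {0..\<delta>})" and sol: "is_solution T \<delta> c u0 u1 u"
  defines "Q \<equiv> {0..T} \<times> {0..\<delta>}" and "S \<equiv> {0..T} \<times> {0<..\<delta>}"
  shows "wave_equation T \<delta> c (partial_t Q c) (partial_x Q c)
    u (partial_t S u) (partial_x S u) (partial_t S (partial_t S u))"
proof -
  have sub: "S \<subseteq> Q" "{0<..\<delta>} \<subseteq> {0..\<delta>}" by (auto simp: Q_def S_def)
  have cQ: "continuous_on Q c" "partially_differentiable_on c Q" "continuous_on Q (partial_x Q c)"
    using c by (auto simp: Q_def)
  have "Ck_on (Suc (Suc 0)) u S" and eq: "\<And>z. z \<in> S \<Longrightarrow>
      partial_t S (partial_t S u) z = partial_x S (\<lambda>y. (c y)\<^sup>2 * partial_x S u y) z"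
    using sol by (auto simp: is_solution_def Let_def S_def numeral_2_eq_2)
  then have u: "continuous_on S u" "partially_differentiable_on u S"
      "continuous_on S (partial_t S u)" "partially_differentiable_on (partial_t S u) S"
      "continuous_on S (partial_t S (partial_t S u))"
      "continuous_on S (partial_x S u)" "partially_differentiable_on (partial_x S u) S"
    by simp_all
  note pd = cQ(2)[unfolded Q_def] u(2,4,7)[unfolded S_def]
  \<comment> \<open>Derivatives of c are formed on the closed rectangle, those of u for x > 0 only;
    the slices of c are restricted accordingly.\<close>
  have c_x: "((\<lambda>y. c (t, y)) has_real_derivative partial_x Q c (t, x)) (at x within {0<..\<delta>})"
    if "t \<in> {0..T}" "x \<in> {0<..\<delta>}" for t x
    unfolding Q_def
    by (rule DERIV_subset[OF partial_x_has_derivative[OF partially_differentiable_onD_x[OF pd(1)]] sub(2)])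
       (use that in auto)
  show ?thesis
  proof
    fix t x assume tx: "t \<in> {0..T}" "x \<in> {0<..\<delta>}"
    show "((\<lambda>s. c (s, x)) has_real_derivative partial_t Q c (t, x)) (at t within {0..T})"
      unfolding Q_def using tx by (intro partial_t_has_derivative[OF pd(1)]) auto
    show "((\<lambda>s. u (s, x)) has_real_derivative partial_t S u (t, x)) (at t within {0..T})"
      unfolding S_def using tx by (intro partial_t_has_derivative pd(2)[unfolded S_def])
    show "((\<lambda>s. partial_t S u (s, x)) has_real_derivative partial_t S (partial_t S u) (t, x)) (at t within {0..T})"
      using partial_t_has_derivative[OF pd(3) tx] by (simp add: S_def)
    show "((\<lambda>y. u (t, y)) has_real_derivative partial_x S u (t, x)) (at x within {0<..\<delta>})"
      unfolding S_def using tx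
      by (intro partial_x_has_derivative partially_differentiable_onD_x[OF pd(2)])
    show "((\<lambda>y. (c (t, y))\<^sup>2 * partial_x S u (t, y)) has_real_derivative
        partial_t S (partial_t S u) (t, x)) (at x within {0<..\<delta>})"
    proof -
      \<comment> \<open>The equation speaks of \<open>partial_x\<close> of a product, a value that
        is a genuine derivative only once the product is known to be differentiable.\<close>
      have "(\<lambda>y. c (t, y)) differentiable (at x within {0<..\<delta>})"
        using c_x[OF tx] by (auto simp: real_differentiable_def)
      then have "(\<lambda>y. (c (t, y))\<^sup>2 * partial_x S u (t, y)) differentiable (at x within {0<..\<delta>})"
        using partially_differentiable_onD_x[OF pd(4) tx]
        by (intro differentiable_mult differentiable_power) (auto simp: S_def)
      then show ?thesis
        using partial_x_has_derivative[of "\<lambda>y. (c y)\<^sup>2 * partial_x S u y" t x "{0<..\<delta>}" "{0..T}"] tx eq[of "(t, x)"]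
        by (simp add: S_def)
    qed
  qed (use c_x cQ u sub in \<open>auto simp flip: S_def intro: continuous_on_subset\<close>)
qed

section \<open>The estimate near the degenerate line x = 0\<close>

text \<open>Expresses all bounds on a triangle lying over [x/2, 3x/2] in powers of its apex
  coordinate x.\<close>

lemma powr_comparable:
  fixes r x y :: real
  assumes "0 \<le> r" "0 < x" "x / 2 \<le> y" "y \<le> 3 / 2 * x"
  shows "(1/2) powr r * x powr r \<le> y powr r" "y powr r \<le> (3/2) powr r * x powr r"
  using powr_mono2[of r "1/2 * x" y] powr_mono2[of r y "3/2 * x"] assms
  by (simp_all only: powr_mult)

theorem theorem1p1:
  fixes p \<alpha> \<beta> T \<delta> L0 L1 L2 L3 L4 K0 K1 K2 K3 :: real
    and c u :: "real \<times> real \<Rightarrow> real"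
    and u0 u1 :: "real \<Rightarrow> real"
  assumes "p > 1" and "\<alpha> > \<beta>" and "\<beta> > 0" and "T > 0" and "\<delta> > 0"
    and "L0 > 0" and "L1 > 0" and "L2 > 0" and "L3 > 0" and "L4 > 0"
    and "K0 > 0" and "K1 > 0" and "K2 > 0" and "K3 > 0"
    and "Ck_on 1 c ({0..T} \<times> {0..\<delta>})"
    and "\<And>t x. t \<in> {0..T} \<Longrightarrow> x \<in> {0..\<delta>} \<Longrightarrow>
           L0 * x powr p \<le> c (t, x) \<and> c (t, x) \<le> L1 * x powr p"
    and "\<And>t x. t \<in> {0..T} \<Longrightarrow> x \<in> {0..\<delta>} \<Longrightarrow>
           L2 * x powr (p - 1) \<le> partial_x ({0..T} \<times> {0..\<delta>}) c (t, x) \<and>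
           partial_x ({0..T} \<times> {0..\<delta>}) c (t, x) \<le> L3 * x powr (p - 1)"
    and "\<And>t x. t \<in> {0..T} \<Longrightarrow> x \<in> {0..\<delta>} \<Longrightarrow>
           \<bar>partial_t ({0..T} \<times> {0..\<delta>}) c (t, x)\<bar> \<le> L4 * x powr p"
    and "\<And>x. x \<in> {0..\<delta>} \<Longrightarrow> K0 * x powr \<alpha> \<le> u0 x \<and> u0 x \<le> K1 * x powr \<alpha>"
    and "\<And>x. x \<in> {0..\<delta>} \<Longrightarrow> K2 * x powr \<beta> \<le> u1 x \<and> u1 x \<le> K3 * x powr \<beta>"
    and "is_solution T \<delta> c u0 u1 u"
  shows "\<exists>T1 \<delta>1 C1 C2. 0 < T1 \<and> T1 \<le> T \<and> 0 < \<delta>1 \<and> \<delta>1 < \<delta> \<and> 0 < C1 \<and> 0 < C2 \<and>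
           (\<forall>t\<in>{0..T1}. \<forall>x\<in>{0..\<delta>1}.
              C1 * t * x powr \<beta> \<le> u (t, x) \<and> u (t, x) \<le> C2 * x powr \<beta>)"
proof -
  note p = assms(1) and ab = assms(2,3) and T = assms(4) and \<delta> = assms(5)
    and L_pos = assms(6-10) and K_pos = assms(11-14) and c_bd = assms(16) and cx_bd = assms(17)
    and ct_bd = assms(18) and u0_bd = assms(19) and u1_bd = assms(20) and sol = assms(21)
  define Q where "Q = {0..T} \<times> {0..\<delta>}"
  define S where "S = {0..T} \<times> {0<..\<delta>}"
  obtain v where contu: "continuous_on Q u" and v: "\<And>z. z \<in> S \<Longrightarrow> v z = partial_t S u z"
    and init: "\<And>x. x \<in> {0..\<delta>} \<Longrightarrow> u (0, x) = u0 x" "\<And>x. x \<in> {0..\<delta>} \<Longrightarrow> v (0, x) = u1 x"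
    using sol unfolding is_solution_def Let_def Q_def S_def by blast
  have init_t: "partial_t S u (0, x) = u1 x" if "x \<in> {0<..\<delta>}" for x
    using v[of "(0, x)"] init(2)[of x] that T by (simp add: S_def)
  interpret wave_equation T \<delta> c "partial_t Q c" "partial_x Q c"
    u "partial_t S u" "partial_x S u" "partial_t S (partial_t S u)"
    unfolding Q_def S_def using assms(15) sol by (rule solution_wave_equation)
  \<comment> \<open>With P = x^p and X = x^\<beta>, on the triangle with apex (t, x): c lies between
    \<open>a0 * P\<close> and \<open>a1 * P\<close>, the coefficient of order zero is at most
    \<open>a2 * P\<close>, the initial velocity lies between \<open>b0 * X\<close> and
    \<open>b1 * X\<close>, and u_0 is at most b2 x^\<alpha>.\<close>
  define a0 where "a0 = L0 * (1/2) powr p"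
  define a1 where "a1 = L1 * (3/2) powr p"
  define a2 where "a2 = L4 * (3/2) powr p + a1 * (L3 * \<delta> powr (p - 1))"
  define b0 where "b0 = K2 * (1/2) powr \<beta>"
  define b1 where "b1 = K3 * (3/2) powr \<beta>"
  define b2 where "b2 = K1 * (3/2) powr \<alpha>"
  have pos: "a0 > 0" "a1 > 0" "a2 > 0" "b0 > 0" "b1 > 0" "b2 > 0"
    using L_pos K_pos \<delta> by (simp_all add: a0_def a1_def a2_def b0_def b1_def b2_def add_pos_pos)
  \<comment> \<open>The share, in units of X, allowed to each of the contributions of u_0 and u_1 to
    N. It is chosen so that \<open>4 * a1 * \<eta> = a0 * C2\<close>, which makes the error at most
    half of the main term.\<close>
  define \<eta> where "\<eta> = a0 * b0 / (4 * a2) * (a0 / (2 * a1))"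
  have "\<eta> > 0" using pos by (simp add: \<eta>_def)
  \<comment> \<open>The entries ensure in turn: times within [0, T], half-width of the triangle at
    most x/2, absorption of the error, and \<open>b1 * t \<le> \<eta>\<close>.\<close>
  define T1 where "T1 = Min {T, 1 / (2 * a1 * \<delta> powr (p - 1)), a0 / (2 * a2), \<eta> / b1}"
  \<comment> \<open>The first entry keeps 3x/2 below \<delta>; the second makes b2 x^\<alpha> at
    most \<eta> x^\<beta>, using \<alpha> > \<beta>.\<close>
  define \<delta>1 where "\<delta>1 = min (\<delta> / 2) ((\<eta> / b2) powr (1 / (\<alpha> - \<beta>)))"
  have "T1 > 0" using T \<delta> pos \<open>\<eta> > 0\<close> by (simp add: T1_def)
  have T1: "T1 \<le> T" "T1 \<le> 1 / (2 * a1 * \<delta> powr (p - 1))" "T1 \<le> a0 / (2 * a2)" "T1 \<le> \<eta> / b1"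
    by (simp_all add: T1_def)
  have \<delta>1: "0 < \<delta>1" "\<delta>1 \<le> \<delta> / 2" "\<delta>1 < \<delta>"
    using \<delta> pos \<open>\<eta> > 0\<close> by (auto simp: \<delta>1_def)
  have \<delta>1_powr: "b2 * x powr (\<alpha> - \<beta>) \<le> \<eta>" if "0 < x" "x \<le> \<delta>1" for x
  proof -
    have "x powr (\<alpha> - \<beta>) \<le> ((\<eta> / b2) powr (1 / (\<alpha> - \<beta>))) powr (\<alpha> - \<beta>)"
      using that ab by (intro powr_mono2) (auto simp: \<delta>1_def)
    also have "\<dots> = \<eta> / b2" using ab pos \<open>\<eta> > 0\<close> by (simp add: powr_powr)
    finally show ?thesis using pos by (simp add: field_simps)
  qed
  \<comment> \<open>\<open>C1\<close> is half of the main rate \<open>a0 * b0\<close> divided by the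
    upper constant for c; \<open>C2\<close> is the size of N at which \<open>a2 * N\<close> equals
    half of \<open>a0 * b0 * X\<close>.\<close>
  define C1 where "C1 = a0 * b0 / (2 * a1)"
  define C2 where "C2 = a0 * b0 / (2 * a2)"
  have C: "0 < C1" "0 < C2" using pos by (simp_all add: C1_def C2_def)
  \<comment> \<open>The bound on |u| is what squeezes u to 0 as x tends to 0.\<close>
  have interior: "C1 * t * x powr \<beta> \<le> u (t, x) \<and> \<bar>u (t, x)\<bar> \<le> C2 * x powr \<beta>"
    if t: "t \<in> {0..T1}" and x: "0 < x" "x \<le> \<delta>1" for t x
  proof -
    define P where "P = x powr p"
    define X where "X = x powr \<beta>"
    have PX: "0 < P" "0 < X" using x by (simp_all add: P_def X_def)
    have P_eq: "P = x * x powr (p - 1)" using x by (simp add: P_def powr_mult_base)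
    have "x powr (p - 1) \<le> \<delta> powr (p - 1)" using x \<delta>1 p by (intro powr_mono2) auto
    then have "P \<le> x * \<delta> powr (p - 1)" unfolding P_eq using x by simp
    \<comment> \<open>The width follows from the slope \<open>a1 * P\<close> alone, before c is
      estimated on the triangle; so using that slope as a speed bound afterwards is not
      circular.\<close>
    then have "a1 * P * t \<le> a1 * (x * \<delta> powr (p - 1)) * T1"
      using t pos PX \<open>T1 > 0\<close> x by (intro mult_mono) auto
    also have "\<dots> \<le> x / 2"
      using T1(2) pos \<delta> x by (simp add: field_simps)
    finally have width: "a1 * P * t \<le> x / 2" .
    let ?\<Omega> = "backward_triangle (a1 * P) t x"
    have range: "s \<in> {0..T}" "y \<in> {0<..\<delta>}" "x / 2 \<le> y" "y \<le> 3 / 2 * x" if "(s, y) \<in> ?\<Omega>" for s y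
    proof -
      have s: "0 \<le> s" "s \<le> t" and "\<bar>y - x\<bar> \<le> a1 * P * (t - s)"
        using that by (auto simp: backward_triangle_def)
      note this(3)
      also have "\<dots> \<le> a1 * P * t" using s pos PX by (intro mult_left_mono) auto
      finally have "\<bar>y - x\<bar> \<le> x / 2" using width by linarith
      then show "x / 2 \<le> y" "y \<le> 3 / 2 * x" by linarith+
      then show "s \<in> {0..T}" "y \<in> {0<..\<delta>}" using s t T1(1) x \<delta>1 by auto
    qed
    have c_range: "a0 * P \<le> c (s, y)" "c (s, y) \<le> a1 * P" if "(s, y) \<in> ?\<Omega>" for s y
    proof -
      note y = powr_comparable[of p x y, OF _ x(1) range(3,4)[OF that]]
      have "L0 * ((1/2) powr p * x powr p) \<le> L0 * y powr p" "L1 * y powr p \<le> L1 * ((3/2) powr p * x powr p)"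
        using y p L_pos by (auto intro!: mult_left_mono)
      then show "a0 * P \<le> c (s, y)" "c (s, y) \<le> a1 * P"
        using c_bd[of s y] range[OF that] by (auto simp: a0_def a1_def P_def mult.assoc)
    qed
    obtain N where N: "\<bar>u (t, x)\<bar> \<le> N" "a0 * P * N \<le> 2 * (a1 * P * (b2 * x powr \<alpha>) + a1 * P * (b1 * X) * t)"
      "(a0 * P * (b0 * X) - a2 * P * N) * t \<le> c (t, x) * u (t, x)"
    proof (rule apex_bounds[of "a1 * P" t x "a0 * P" "a1 * P" "b0 * X" "a2 * P" "b1 * X" "b2 * x powr \<alpha>"])
      show "?\<Omega> \<subseteq> {0..T} \<times> {0<..\<delta>}" using range by auto
      show "a0 * P \<le> c z \<and> c z \<le> a1 * P" if "z \<in> ?\<Omega>" for z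
        using c_range that by (cases z) auto
      have "a2 * t \<le> a0 / 2"
        using mult_left_mono[of t "a0 / (2 * a2)" a2] t T1(3) pos by auto
      then show "a2 * P * t \<le> a0 * P / 2"
        using mult_right_mono[of "a2 * t" "a0 / 2" P] PX by (simp add: algebra_simps)
      show "\<bar>partial_t Q c z\<bar> + c z * \<bar>partial_x Q c z\<bar> \<le> a2 * P" if z: "z \<in> ?\<Omega>" for z
      proof -
        obtain s y where sy: "z = (s, y)" by (cases z)
        note r = range[OF z[unfolded sy]]
        have "\<bar>partial_t Q c z\<bar> \<le> L4 * y powr p"
          using ct_bd[of s y] r by (simp add: sy Q_def)
        also have "\<dots> \<le> L4 * ((3/2) powr p * P)"
          unfolding P_def using powr_comparable(2)[of p x y] r x p L_pos by (intro mult_left_mono) auto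
        finally have 1: "\<bar>partial_t Q c z\<bar> \<le> L4 * (3/2) powr p * P" by (simp add: mult.assoc)
        \<comment> \<open>The lower bound makes c_x nonnegative, so its upper bound also controls
          |c_x|.\<close>
        have "0 \<le> L2 * y powr (p - 1)" using L_pos by simp
        then have "\<bar>partial_x Q c z\<bar> \<le> L3 * y powr (p - 1)"
          using cx_bd[of s y] r by (auto simp: sy Q_def)
        also have "\<dots> \<le> L3 * \<delta> powr (p - 1)"
          using r p L_pos by (intro mult_left_mono powr_mono2) auto
        finally have "c z * \<bar>partial_x Q c z\<bar> \<le> a1 * P * (L3 * \<delta> powr (p - 1))"
          using c_range[OF z[unfolded sy]] pos PX unfolding sy by (intro mult_mono) auto
        with 1 show ?thesis by (simp add: a2_def algebra_simps)
      qed
      show "b0 * X \<le> partial_t S u (0, y) \<and> partial_t S u (0, y) \<le> b1 * X" if "(0, y) \<in> ?\<Omega>" for y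
      proof -
        note y = powr_comparable[of \<beta> x y, OF _ x(1) range(3,4)[OF that]]
        have "K2 * ((1/2) powr \<beta> * x powr \<beta>) \<le> K2 * y powr \<beta>" "K3 * y powr \<beta> \<le> K3 * ((3/2) powr \<beta> * x powr \<beta>)"
          using y ab K_pos by (auto intro!: mult_left_mono)
        then show ?thesis
          using u1_bd[of y] range[OF that] init_t[of y] by (auto simp: b0_def b1_def X_def mult.assoc)
      qed
      show "0 \<le> u (0, y) \<and> u (0, y) \<le> b2 * x powr \<alpha>" if "(0, y) \<in> ?\<Omega>" for y
      proof -
        note y = powr_comparable(2)[of \<alpha> x y, OF _ x(1) range(3,4)[OF that]]
        have "0 \<le> K0 * y powr \<alpha>" "K1 * y powr \<alpha> \<le> K1 * ((3/2) powr \<alpha> * x powr \<alpha>)"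
          using y ab K_pos by (auto intro!: mult_left_mono)
        then show ?thesis
          using u0_bd[of y] range[OF that] init(1)[of y] by (auto simp: b2_def mult.assoc)
      qed
    qed (use pos PX t in auto)
    have "x powr \<alpha> = x powr (\<alpha> - \<beta>) * X" by (simp add: X_def flip: powr_add)
    then have "b2 * x powr \<alpha> = b2 * x powr (\<alpha> - \<beta>) * X" by simp
    also have "\<dots> \<le> \<eta> * X" using \<delta>1_powr[OF x] PX by (intro mult_right_mono) auto
    finally have 1: "b2 * x powr \<alpha> \<le> \<eta> * X" .
    have "t \<le> \<eta> / b1" using t T1(4) by simp
    then have "b1 * t \<le> \<eta>" using pos by (simp add: field_simps)
    then have 2: "b1 * X * t \<le> \<eta> * X"
      using mult_right_mono[of "b1 * t" \<eta> X] PX by (simp add: algebra_simps)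
    \<comment> \<open>Every term carries the factor P, so the degeneracy of c cancels from the
      estimate of N.\<close>
    have "P * (a0 * N) \<le> 2 * (a1 * P * (b2 * x powr \<alpha> + b1 * X * t))"
      using N(2) by (simp add: distrib_left mult_ac)
    also have "\<dots> \<le> 2 * (a1 * P * (\<eta> * X + \<eta> * X))"
      using 1 2 pos PX by (intro mult_left_mono add_mono) auto
    also have "\<dots> = P * (4 * a1 * (\<eta> * X))" by simp
    finally have "a0 * N \<le> 4 * a1 * (\<eta> * X)" using PX by simp
    also have "\<dots> = a0 * (C2 * X)" using pos by (simp add: \<eta>_def C2_def field_simps)
    finally have N_le: "N \<le> C2 * X" using pos by simp
    have "a2 * N \<le> a0 * b0 / 2 * X"
      using mult_left_mono[OF N_le, of a2] pos by (simp add: C2_def field_simps)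
    then have "a0 * b0 / 2 * X \<le> a0 * b0 * X - a2 * N" by (simp add: field_simps)
    then have "a0 * b0 / 2 * X * P \<le> (a0 * b0 * X - a2 * N) * P" using PX by (intro mult_right_mono) auto
    also have "\<dots> = a0 * P * (b0 * X) - a2 * P * N" by (simp add: algebra_simps)
    finally have "a0 * b0 / 2 * X * P \<le> a0 * P * (b0 * X) - a2 * P * N" .
    then have "a0 * b0 / 2 * X * P * t \<le> c (t, x) * u (t, x)"
      using N(3) mult_right_mono[of "a0 * b0 / 2 * X * P" "a0 * P * (b0 * X) - a2 * P * N" t] t by simp
    moreover have "(t, x) \<in> ?\<Omega>" using t pos PX by (simp add: backward_triangle_def)
    note c_tx = c_range[OF this]
    moreover have "0 \<le> a0 * b0 / 2 * X * P * t" using pos PX t by simp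
    ultimately have "0 \<le> c (t, x) * u (t, x)" "0 < c (t, x)"
      using mult_pos_pos[of a0 P] pos PX by linarith+
    \<comment> \<open>The sign is needed before c can be replaced by its upper bound
      \<open>a1 * P\<close> in the lower estimate for c u.\<close>
    then have "0 \<le> u (t, x)" by (simp add: zero_le_mult_iff)
    then have "c (t, x) * u (t, x) \<le> a1 * P * u (t, x)" using c_tx by (intro mult_right_mono) auto
    then have "P * (a0 * b0 / 2 * X * t) \<le> P * (a1 * u (t, x))"
      using \<open>a0 * b0 / 2 * X * P * t \<le> c (t, x) * u (t, x)\<close> by (simp add: mult_ac)
    then have "a0 * b0 / 2 * X * t \<le> a1 * u (t, x)" using PX by simp
    then have "C1 * t * X \<le> u (t, x)" using pos by (simp add: C1_def field_simps)
    then show ?thesis using N(1) N_le by (auto simp: X_def)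
  qed
  \<comment> \<open>No triangle has its apex at x = 0; there the value comes from continuity of u on
    the closed rectangle.\<close>
  have boundary: "u (t, 0) = 0" if t: "t \<in> {0..T1}" for t
  proof -
    have "continuous_on {0..\<delta>} (\<lambda>x. u (t, x))"
      by (rule continuous_on_compose2[OF contu]) (use t T1(1) in \<open>auto simp: Q_def intro!: continuous_intros\<close>)
    then have "((\<lambda>x. u (t, x)) \<longlongrightarrow> u (t, 0)) (at_right 0)"
      by (rule continuous_on_Icc_at_rightD[OF _ \<delta>])
    moreover have "((\<lambda>x. u (t, x)) \<longlongrightarrow> 0) (at_right 0)"
    proof (rule Lim_null_comparison)
      show "\<forall>\<^sub>F x in at_right 0. norm (u (t, x)) \<le> C2 * x powr \<beta>"
        using eventually_at_right_less[of "0::real"] eventually_at_right_real[OF \<delta>1(1)]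
        by eventually_elim (use interior t in auto)
      have "((\<lambda>x. C2 * x powr \<beta>) \<longlongrightarrow> C2 * 0 powr \<beta>) (at_right 0)"
        using ab by (intro tendsto_intros) (auto intro: eventually_mono[OF eventually_at_right_less[of 0]])
      then show "((\<lambda>x. C2 * x powr \<beta>) \<longlongrightarrow> 0) (at_right 0)" by simp
    qed
    ultimately show ?thesis using tendsto_unique[OF trivial_limit_at_right_real] by blast
  qed
  have "C1 * t * x powr \<beta> \<le> u (t, x) \<and> u (t, x) \<le> C2 * x powr \<beta>"
    if "t \<in> {0..T1}" "x \<in> {0..\<delta>1}" for t x
    \<comment> \<open>Since \<open>0 powr \<beta>\<close> is 0, both inequalities at x = 0 read 0
      \<le> 0.\<close>
    using interior[of t x] boundary[of t] that by (cases "x = 0") auto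
  then show ?thesis
    using \<open>T1 > 0\<close> T1(1) \<delta>1 C by blast
qed

end
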